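(* Let $G=\mathbb A(\mathfrak g)=\mathbb A^{0|n}$ be the additive supergroup of the super-vector space $\mathfrak g=\mathbb C^{0|n}$, let $T=\mathbb A(\mathfrak g^* )$, and let $\pi$ be the representation of $G_T=T\times G$ given by the character $\pi=e^{i\sum_j\theta_j\xi^j}$. For any superfunction $f$ on $G$, one has $$\int_TD(\theta)\,\mathrm{str}\,\pi(f)=(-1)^{n(n+1)/2}\,i^n f_0(0),$$ where $$\pi(f)=\int_GD(\xi)\,f\,\pi$$ and the integrals are Berezin integrals.
   Context: Here $\theta_1,\dots,\theta_n$ is a basis of $\mathfrak g$, regarded as odd coordinate functions on $T=\mathbb A(\mathfrak g^* )$, and $\xi^1,\dots,\xi^n$ is the dual basis of $\mathfrak g^*$, regarded as odd coordinate functions on $G$; so $\Gamma(\mathcal O_G)=\bigwedge(\xi^1,\dots,\xi^n)$, $\Gamma(\mathcal O_T)=\bigwedge(\theta_1,\dots,\theta_n)$ and $\Gamma(\mathcal O_{T\times G})=\bigwedge(\theta_1,\dots,\theta_n,\xi^1,\dots,\xi^n)$ over $\mathbb C$, all generators anticommuting. The representation $\pi$ acts on the free $\mathcal O_T$-module of rank $1|0$ with basis $\psi_0=e^{-i\sum_j\theta_j\xi^j}$ (the $\mathfrak g_T$-polarised sections attached to the generic point $\mathrm{id}_T$ of $\mathfrak g^*$, inside the left-regular representation of $G_T$): $\pi(g)\psi_0=e^{i\sum_j\theta_jg^j}\psi_0$ where $g^j=g^\sharp(\xi^j)$. Thus $\pi(f)$ acts as multiplication by a superfunction on $T$ and, the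 module having rank $1|0$, $\mathrm{str}\,\pi(f)$ is that superfunction. $f_0(0)$ is the value of $f$ at the unique point $0$ of $G$, i.e. its component in $\bigwedge^0$. Berezin integrals: $\int_TD(\theta)$ picks the coefficient of $\theta_1\cdots\theta_n$; $\int_GD(\xi)$ is the $\Gamma(\mathcal O_T)$-linear map of parity $n$ (linear with the sign rule) from $\Gamma(\mathcal O_{T\times G})$ to $\Gamma(\mathcal O_T)$ with $\int_GD(\xi)\,\theta_I\,\xi^J=0$ unless $\xi^J=\xi^1\cdots\xi^n$, and $\int_GD(\xi)\,\theta_I\,\xi^1\cdots\xi^n=(-1)^{n|I|}\theta_I$. *)

theory Defs
  imports Complex_Main "HOL-Library.Product_Lexorder"
begin

section \<open>Exterior algebras\<close>

text \<open>An element of the complex exterior algebra on anticommuting generators \<open>\<zeta>\<^sub>a\<close>, with \<open>a\<close> in a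
  linearly ordered type, is given by its coefficients with respect to the monomials \<open>\<zeta>\<^sub>A\<close>, the
  products of the \<open>\<zeta>\<^sub>a\<close> for \<open>a \<in> A\<close> in increasing order. Over infinitely many generators the type
  also contains infinite formal sums of monomials; \<open>exterior_on S\<close> for finite \<open>S\<close>, defined below, is
  the ordinary exterior algebra on the generators in \<open>S\<close>.\<close>

typedef 'a exterior = "{x :: 'a set \<Rightarrow> complex. \<forall>A. infinite A \<longrightarrow> x A = 0}"
  morphisms coeff Abs_exterior
  by (rule exI[of _ "\<lambda>_. 0"]) simp

setup_lifting type_definition_exterior

lemma exterior_eqI: "(\<And>A. finite A \<Longrightarrow> coeff x A = coeff y A) \<Longrightarrow> x = y"
  by transfer (metis ext)

lemma coeff_infinite: "infinite A \<Longrightarrow> coeff x A = 0"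
  by transfer simp

text \<open>For disjoint finite \<open>A\<close> and \<open>B\<close> one has \<open>\<zeta>\<^sub>A \<zeta>\<^sub>B = reorder_sign A B \<zeta>\<^sub>A\<^sub>\<union>\<^sub>B\<close>.\<close>

definition reorder_sign :: "'a::linorder set \<Rightarrow> 'a set \<Rightarrow> complex" where
  "reorder_sign A B = (-1) ^ card {(a, b) \<in> A \<times> B. b < a}"

lemma reorder_sign_empty [simp]: "reorder_sign {} B = 1" "reorder_sign A {} = 1"
  by (simp_all add: reorder_sign_def)

lemma reorder_sign_Un_left:
  assumes "finite A" "finite B" "finite C" "A \<inter> B = {}"
  shows "reorder_sign (A \<union> B) C = reorder_sign A C * reorder_sign B C"
proof -
  have "{(a, c) \<in> (A \<union> B) \<times> C. c < a} = {(a, c) \<in> A \<times> C. c < a} \<union> {(a, c) \<in> B \<times> C. c < a}"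
    by auto
  moreover have "finite {(a, c) \<in> A \<times> C. c < a}" "finite {(a, c) \<in> B \<times> C. c < a}"
    by (rule finite_subset[of _ "A \<times> C"] finite_subset[of _ "B \<times> C"]; use assms in auto)+
  ultimately show ?thesis using assms(4)
    unfolding reorder_sign_def by (subst power_add[symmetric], subst card_Un_disjoint[symmetric]) auto
qed

lemma reorder_sign_Un_right:
  assumes "finite A" "finite B" "finite C" "B \<inter> C = {}"
  shows "reorder_sign A (B \<union> C) = reorder_sign A B * reorder_sign A C"
proof -
  have "{(a, c) \<in> A \<times> (B \<union> C). c < a} = {(a, c) \<in> A \<times> B. c < a} \<union> {(a, c) \<in> A \<times> C. c < a}"
    by auto
  moreover have "finite {(a, c) \<in> A \<times> B. c < a}" "finite {(a, c) \<in> A \<times> C. c < a}"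
    by (rule finite_subset[of _ "A \<times> B"] finite_subset[of _ "A \<times> C"]; use assms in auto)+
  ultimately show ?thesis using assms(4)
    unfolding reorder_sign_def by (subst power_add[symmetric], subst card_Un_disjoint[symmetric]) auto
qed

instantiation exterior :: (type) ab_group_add
begin

lift_definition zero_exterior :: "'a exterior" is "\<lambda>_. 0" by simp
lift_definition plus_exterior :: "'a exterior \<Rightarrow> 'a exterior \<Rightarrow> 'a exterior"
  is "\<lambda>x y A. x A + y A" by simp
lift_definition minus_exterior :: "'a exterior \<Rightarrow> 'a exterior \<Rightarrow> 'a exterior"
  is "\<lambda>x y A. x A - y A" by simp
lift_definition uminus_exterior :: "'a exterior \<Rightarrow> 'a exterior"
  is "\<lambda>x A. - x A" by simp

instance
  by standard (transfer; simp add: algebra_simps)+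

end

lemma coeff_zero [simp]: "coeff 0 A = 0"
  and coeff_add [simp]: "coeff (x + y) A = coeff x A + coeff y A"
  and coeff_diff [simp]: "coeff (x - y) A = coeff x A - coeff y A"
  and coeff_uminus [simp]: "coeff (- x) A = - coeff x A"
  by (transfer; simp)+

lemma coeff_sum [simp]: "coeff (sum f S) A = (\<Sum>s\<in>S. coeff (f s) A)"
  by (induction S rule: infinite_finite_induct) auto

lemma sum_Pow_infinite: "infinite A \<Longrightarrow> sum f (Pow A) = 0"
  by (simp add: finite_Pow_iff)

instantiation exterior :: (linorder) ring_1
begin

lift_definition one_exterior :: "'a exterior" is "\<lambda>A. if A = {} then 1 else 0" by auto

lift_definition times_exterior :: "'a exterior \<Rightarrow> 'a exterior \<Rightarrow> 'a exterior"
  is "\<lambda>x y C. \<Sum>A\<in>Pow C. reorder_sign A (C - A) * x A * y (C - A)"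
  by (simp add: sum_Pow_infinite)

lemma coeff_one: "coeff 1 A = (if A = {} then 1 else 0)"
  by transfer simp

lemma coeff_mult:
  "coeff (x * y) C = (\<Sum>A\<in>Pow C. reorder_sign A (C - A) * coeff x A * coeff y (C - A))"
  by transfer simp

instance
proof
  fix x y z :: "'a exterior"
  show "x * y * z = x * (y * z)"
  proof (rule exterior_eqI)
    fix C :: "'a set" assume C: "finite C"
    let ?f = "\<lambda>(B, A). reorder_sign B (C - B) * (reorder_sign A (B - A) * coeff x A * coeff y (B - A))
      * coeff z (C - B)"
    let ?g = "\<lambda>(A, D). reorder_sign A (C - A) * coeff x A *
      (reorder_sign D (C - A - D) * coeff y D * coeff z (C - A - D))"
    have fin: "finite (Pow C)" "\<And>B. B \<in> Pow C \<Longrightarrow> finite (Pow B)" "\<And>B. finite (Pow (C - B))"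
      using C finite_subset by auto
    have "coeff (x * y * z) C = sum ?f (Sigma (Pow C) Pow)"
      by (subst sum.Sigma[symmetric])
         (use fin in \<open>auto simp: coeff_mult sum_distrib_left sum_distrib_right\<close>)
    also have "\<dots> = sum ?g (Sigma (Pow C) (\<lambda>A. Pow (C - A)))"
    proof (rule sum.reindex_bij_witness[of _ "\<lambda>(A, D). (A \<union> D, A)" "\<lambda>(B, A). (A, B - A)"])
      fix p assume p: "p \<in> Sigma (Pow C) Pow"
      obtain B A where [simp]: "p = (B, A)" by (cases p)
      have sub: "A \<subseteq> B" "B \<subseteq> C" using p by auto
      have fins: "finite A" "finite B" using sub C by (auto dest: finite_subset)
      have eq: "C - A - (B - A) = C - B" using sub by auto
      have s1: "reorder_sign B (C - B) = reorder_sign A (C - B) * reorder_sign (B - A) (C - B)"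
        using reorder_sign_Un_left[of A "B - A" "C - B"] sub fins C by (simp add: Un_absorb1)
      have CA: "(B - A) \<union> (C - B) = C - A" using sub by auto
      have s2: "reorder_sign A (C - A) = reorder_sign A (B - A) * reorder_sign A (C - B)"
        using reorder_sign_Un_right[of A "B - A" "C - B"] fins C unfolding CA by auto
      show "?g (case p of (B, A) \<Rightarrow> (A, B - A)) = ?f p"
        by (simp add: eq s1 s2)
    qed auto
    also have "\<dots> = coeff (x * (y * z)) C"
      by (subst sum.Sigma[symmetric])
         (use fin C in \<open>auto simp: coeff_mult sum_distrib_left\<close>)
    finally show "coeff (x * y * z) C = coeff (x * (y * z)) C" .
  qed
  show "1 * x = x"
  proof (rule exterior_eqI)
    fix C :: "'a set" assume C: "finite C"
    have "coeff (1 * x) C = (\<Sum>A\<in>Pow C. if A = {} then coeff x C else 0)"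
      unfolding coeff_mult by (rule sum.cong) (auto simp: coeff_one)
    also have "\<dots> = coeff x C" using C by (subst sum.delta) auto
    finally show "coeff (1 * x) C = coeff x C" .
  qed
  show "x * 1 = x"
  proof (rule exterior_eqI)
    fix C :: "'a set" assume C: "finite C"
    have "coeff (x * 1) C = (\<Sum>A\<in>Pow C. if A = C then coeff x C else 0)"
      unfolding coeff_mult by (rule sum.cong) (auto simp: coeff_one)
    also have "\<dots> = coeff x C" using C by (subst sum.delta) auto
    finally show "coeff (x * 1) C = coeff x C" .
  qed
  show "(x + y) * z = x * z + y * z" "x * (y + z) = x * y + x * z"
    by (rule exterior_eqI; simp add: coeff_mult algebra_simps sum.distrib)+
  show "(0::'a exterior) \<noteq> 1"
    by (metis coeff_one coeff_zero zero_neq_one)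
qed

end

definition exterior_on :: "'a set \<Rightarrow> 'a exterior set" where
  "exterior_on S = {x. \<forall>A. coeff x A \<noteq> 0 \<longrightarrow> A \<subseteq> S}"

definition has_parity :: "nat \<Rightarrow> 'a exterior \<Rightarrow> bool" where
  "has_parity p x \<longleftrightarrow> (\<forall>A. coeff x A \<noteq> 0 \<longrightarrow> even (card A + p))"

lift_definition monomial :: "'a set \<Rightarrow> 'a exterior" is
  "\<lambda>A B. if B = A \<and> finite A then 1 else 0"
  by auto

abbreviation generator :: "'a \<Rightarrow> 'a exterior" where
  "generator a \<equiv> monomial {a}"

lift_definition scalar :: "complex \<Rightarrow> 'a exterior" is
  "\<lambda>c A. if A = {} then c else 0"
  by auto

lemma coeff_monomial: "coeff (monomial A) B = (if B = A \<and> finite A then 1 else 0)"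
  by transfer simp

lemma coeff_scalar: "coeff (scalar c) A = (if A = {} then c else 0)"
  by transfer simp

lemma coeff_scalar_mult [simp]: "coeff (scalar c * x) C = c * coeff x C"
proof (cases "finite C")
  case True
  have "coeff (scalar c * x) C = (\<Sum>A\<in>Pow C. if A = {} then c * coeff x C else 0)"
    unfolding coeff_mult by (rule sum.cong) (auto simp: coeff_scalar)
  also have "\<dots> = c * coeff x C" using True by (subst sum.delta) auto
  finally show ?thesis .
qed (simp add: coeff_infinite)

lemma coeff_mult_scalar [simp]: "coeff (x * scalar c) C = c * coeff x C"
proof (cases "finite C")
  case True
  have "coeff (x * scalar c) C = (\<Sum>A\<in>Pow C. if A = C then c * coeff x C else 0)"
    unfolding coeff_mult by (rule sum.cong) (auto simp: coeff_scalar)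
  also have "\<dots> = c * coeff x C" using True by (subst sum.delta) auto
  finally show ?thesis .
qed (simp add: coeff_infinite)

lemma scalar_commute: "x * scalar c = scalar c * x"
  by (rule exterior_eqI) simp

lemma scalar_mult: "scalar c * scalar d = scalar (c * d)"
  by (rule exterior_eqI) (simp add: coeff_scalar)

lemma scalar_one: "scalar 1 = 1"
  by (rule exterior_eqI) (simp add: coeff_scalar coeff_one)

lemma monomial_empty: "monomial {} = 1"
  by (rule exterior_eqI) (simp add: coeff_monomial coeff_one)

lemma monomial_mult:
  assumes "finite A" "finite B"
  shows "monomial A * monomial B =
    (if A \<inter> B = {} then scalar (reorder_sign A B) * monomial (A \<union> B) else 0)"
proof (rule exterior_eqI)
  fix C :: "'a set" assume C: "finite C"
  have "coeff (monomial A * monomial B) C =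
      (\<Sum>D\<in>Pow C. if D = A then (if C - A = B then reorder_sign A B else 0) else 0)"
    unfolding coeff_mult by (rule sum.cong) (use assms in \<open>auto simp: coeff_monomial\<close>)
  also have "\<dots> = (if A \<subseteq> C \<and> C - A = B then reorder_sign A B else 0)"
    using C by (subst sum.delta) auto
  also have "\<dots> = coeff (if A \<inter> B = {} then scalar (reorder_sign A B) * monomial (A \<union> B) else 0) C"
    using assms by (auto simp: coeff_monomial)
  finally show "coeff (monomial A * monomial B) C = \<dots>" .
qed

lemma monomial_eq_prod_list:
  "sorted_wrt (<) xs \<Longrightarrow> monomial (set xs) = prod_list (map generator xs)"
proof (induction xs)
  case (Cons a xs)
  have "{(x, y) \<in> {a} \<times> set xs. y < x} = {}" using Cons.prems by auto
  then have "reorder_sign {a} (set xs) = 1" unfolding reorder_sign_def by (simp only: card.empty power_0)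
  moreover have "{a} \<inter> set xs = {}" using Cons.prems by auto
  ultimately show ?case using Cons monomial_mult[of "{a}" "set xs"] by (simp add: scalar_one)
qed (simp add: monomial_empty)

lemma reorder_sign_swap:
  assumes "finite A" "finite B" "A \<inter> B = {}"
  shows "reorder_sign A B = (-1) ^ (card A * card B) * reorder_sign B A"
proof -
  let ?L = "{(a, b) \<in> A \<times> B. b < a}" and ?R = "{(b, a) \<in> B \<times> A. a < b}"
  have fin: "finite ?L" "finite ?R"
    by (rule finite_subset[of _ "A \<times> B"] finite_subset[of _ "B \<times> A"]; use assms in auto)+
  have "?L \<union> prod.swap ` ?R = A \<times> B" "?L \<inter> prod.swap ` ?R = {}"
    using assms(3) by (auto simp: image_iff neq_iff)
  then have "card ?L + card ?R = card A * card B"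
    using card_Un_disjoint[of ?L "prod.swap ` ?R"] fin card_image[of prod.swap ?R]
    by (simp add: card_cartesian_product inj_on_def)
  then have "(-1 :: complex) ^ (card A * card B) = (-1) ^ card ?L * (-1) ^ card ?R"
    by (simp add: power_add[symmetric])
  moreover have "reorder_sign A B = (-1) ^ card ?L" "reorder_sign B A = (-1) ^ card ?R"
    by (simp_all add: reorder_sign_def)
  moreover have "(-1 :: complex) ^ card ?R * (-1) ^ card ?R = 1"
    by (simp add: power_mult_distrib[symmetric])
  ultimately show ?thesis by (simp add: mult.assoc)
qed

lemma supercommute:
  assumes x: "has_parity p x" and y: "has_parity q y"
  shows "x * y = (-1) ^ (p * q) * (y * x)"
proof (rule exterior_eqI)
  fix C :: "'a set" assume C: "finite C"
  have neg1: "(-1) ^ m * z = scalar ((-1) ^ m) * z" for m and z :: "'a exterior"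
    by (induction m) (auto simp: scalar_one mult.assoc intro!: exterior_eqI)
  have "coeff (x * y) C = (\<Sum>A\<in>Pow C. reorder_sign (C - A) A * coeff x (C - A) * coeff y A)"
    unfolding coeff_mult by (rule sum.reindex_bij_witness[of _ "\<lambda>A. C - A" "\<lambda>A. C - A"])
      (auto simp: double_diff)
  also have "\<dots> = (\<Sum>A\<in>Pow C. (-1) ^ (p * q) * (reorder_sign A (C - A) * coeff y A * coeff x (C - A)))"
  proof (rule sum.cong)
    fix A assume A: "A \<in> Pow C"
    show "reorder_sign (C - A) A * coeff x (C - A) * coeff y A =
      (-1) ^ (p * q) * (reorder_sign A (C - A) * coeff y A * coeff x (C - A))"
    proof (cases "coeff x (C - A) = 0 \<or> coeff y A = 0")
      case False
      then have "even (card (C - A) + p)" "even (card A + q)"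
        using x y unfolding has_parity_def by auto
      then have "(-1 :: complex) ^ (card (C - A) * card A) = (-1) ^ (p * q)"
        by (cases "even p"; cases "even q") auto
      moreover have "reorder_sign (C - A) A = (-1) ^ (card (C - A) * card A) * reorder_sign A (C - A)"
        by (rule reorder_sign_swap) (use A C finite_subset in auto)
      ultimately show ?thesis by simp
    qed auto
  qed simp
  also have "\<dots> = coeff ((-1) ^ (p * q) * (y * x)) C"
    unfolding neg1 coeff_scalar_mult by (simp add: coeff_mult sum_distrib_left)
  finally show "coeff (x * y) C = \<dots>" .
qed

lemma has_parity_generator: "has_parity 1 (generator a)"
  by (simp add: has_parity_def coeff_monomial)

lemma has_parity_add: "has_parity p x \<Longrightarrow> has_parity p y \<Longrightarrow> has_parity p (x + y)"
  unfolding has_parity_def coeff_add by (metis add_0)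

lemma has_parity_scalar: "has_parity p x \<Longrightarrow> has_parity p (scalar c * x)"
  unfolding has_parity_def by simp

lemma has_parity_sum: "(\<And>s. s \<in> S \<Longrightarrow> has_parity p (f s)) \<Longrightarrow> has_parity p (sum f S)"
proof (induction S rule: infinite_finite_induct)
  case (insert s S)
  then show ?case by (simp add: has_parity_add)
qed (simp_all add: has_parity_def)

lemma has_parity_mult:
  assumes "has_parity p x" "has_parity q y"
  shows "has_parity (p + q) (x * y)"
  unfolding has_parity_def
proof (intro allI impI)
  fix C assume ne: "coeff (x * y) C \<noteq> 0"
  then have C: "finite C" using coeff_infinite by blast
  from ne obtain A where A: "A \<in> Pow C" "coeff x A \<noteq> 0" "coeff y (C - A) \<noteq> 0"
    unfolding coeff_mult by (metis (no_types, lifting) mult_eq_0_iff sum.neutral)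
  then have "even (card A + p)" "even (card (C - A) + q)"
    using assms unfolding has_parity_def by auto
  moreover have "card C = card A + card (C - A)"
    using A C by (metis PowD card_Diff_subset card_mono finite_subset le_add_diff_inverse)
  ultimately show "even (card C + (p + q))" by auto
qed

lemma even_commute: "has_parity 0 x \<Longrightarrow> has_parity 0 y \<Longrightarrow> x * y = y * x"
  using supercommute[of 0 x 0 y] by simp


section \<open>The exponential\<close>

text \<open>The exponential series, summed coefficientwise. If \<open>x\<close> has no constant term, only finitely
  many powers of \<open>x\<close> contribute to each coefficient.\<close>

lift_definition exterior_exp :: "'a::linorder exterior \<Rightarrow> 'a exterior" is
  "\<lambda>x A. \<Sum>k. coeff (Abs_exterior x ^ k) A / fact k"
  by (simp add: coeff_infinite)

lemma coeff_exterior_exp: "coeff (exterior_exp x) A = (\<Sum>k. coeff (x ^ k) A / fact k)"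
  by (simp add: exterior_exp.rep_eq coeff_inverse)

definition order_ge :: "nat \<Rightarrow> 'a exterior \<Rightarrow> bool" where
  "order_ge m x \<longleftrightarrow> (\<forall>A. card A < m \<longrightarrow> coeff x A = 0)"

lemma order_ge_mult:
  assumes "order_ge l x" "order_ge m y"
  shows "order_ge (l + m) (x * y)"
  unfolding order_ge_def
proof (intro allI impI)
  fix C :: "'a set" assume c: "card C < l + m"
  show "coeff (x * y) C = 0"
  proof (cases "finite C")
    case True
    have "coeff x A = 0 \<or> coeff y (C - A) = 0" if "A \<subseteq> C" for A
    proof -
      have "card C = card A + card (C - A)"
        using that True by (metis card_Diff_subset card_mono finite_subset le_add_diff_inverse)
      then have "card A < l \<or> card (C - A) < m" using c by linarith
      then show ?thesis using assms unfolding order_ge_def by auto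
    qed
    then show ?thesis unfolding coeff_mult by (intro sum.neutral) auto
  qed (simp add: coeff_infinite)
qed

lemma order_ge_one_iff: "order_ge 1 x \<longleftrightarrow> coeff x {} = 0"
  unfolding order_ge_def by (auto simp: card_eq_0_iff coeff_infinite)

lemma order_ge_power: "coeff x {} = 0 \<Longrightarrow> order_ge k (x ^ k)"
proof (induction k)
  case (Suc k)
  then show ?case using order_ge_mult[of 1 x k "x ^ k"] order_ge_one_iff[of x] by simp
qed (simp add: order_ge_def)

lemma coeff_exterior_exp_finite:
  assumes "coeff x {} = 0" "card A \<le> N"
  shows "coeff (exterior_exp x) A = (\<Sum>k\<le>N. coeff (x ^ k) A / fact k)"
  unfolding coeff_exterior_exp
  by (rule suminf_finite) (use assms order_ge_power[of x] in \<open>auto simp: order_ge_def\<close>)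

lemma exterior_exp_zero: "exterior_exp 0 = 1"
proof (rule exterior_eqI)
  fix A :: "'a set"
  have "coeff ((0 :: 'a exterior) ^ k) A / fact k = (if k = 0 then coeff 1 A else 0)" for k
    by (cases k) auto
  then show "coeff (exterior_exp 0) A = coeff 1 A"
    by (simp add: coeff_exterior_exp_finite[OF _ order_refl])
qed

definition exp_term :: "'a::linorder exterior \<Rightarrow> nat \<Rightarrow> 'a exterior" where
  "exp_term x k = scalar (1 / fact k) * x ^ k"

lemma exp_term_add_commuting:
  assumes "x * y = y * x"
  shows "exp_term (x + y) k = (\<Sum>i\<le>k. exp_term x i * exp_term y (k - i))"
proof (induction k)
  case 0
  show ?case by (simp add: exp_term_def scalar_one)
next
  case (Suc k)
  have S: "scalar (of_nat (Suc m)) * exp_term z (Suc m) = z * exp_term z m" for z :: "'a exterior" and m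
  proof -
    have "scalar (of_nat (Suc m)) * exp_term z (Suc m) = scalar (1 / fact m) * (z * z ^ m)"
      unfolding exp_term_def
      by (rule exterior_eqI) (simp add: field_simps del: of_nat_Suc)
    then show ?thesis
      unfolding exp_term_def by (metis mult.assoc scalar_commute)
  qed
  have comm: "exp_term x m * y = y * exp_term x m" for m
  proof -
    have "x ^ m * y = y * x ^ m" using assms by (metis power_commuting_commutes)
    then show ?thesis unfolding exp_term_def by (metis mult.assoc scalar_commute)
  qed
  have scal_add: "scalar (a + b) = scalar a + (scalar b :: 'a exterior)" for a b
    by (rule exterior_eqI) (simp add: coeff_scalar)
  have "scalar (of_nat (Suc k)) * exp_term (x + y) (Suc k) =
      (x + y) * (\<Sum>i\<le>k. exp_term x i * exp_term y (k - i))"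
    using Suc S by simp
  also have "\<dots> = (\<Sum>i\<le>k. (x * exp_term x i) * exp_term y (k - i)) +
      (\<Sum>i\<le>k. exp_term x i * (y * exp_term y (k - i)))"
    by (simp only: distrib_right sum_distrib_left sum.distrib[symmetric])
       (rule sum.cong, simp_all add: comm distrib_right mult.assoc[symmetric])
  also have "(\<Sum>i\<le>k. (x * exp_term x i) * exp_term y (k - i)) =
      (\<Sum>i\<le>k. scalar (of_nat (Suc i)) * (exp_term x (Suc i) * exp_term y (Suc k - Suc i)))"
    by (simp add: S[symmetric] mult.assoc)
  also have "\<dots> = (\<Sum>i\<le>Suc k. scalar (of_nat i) * (exp_term x i * exp_term y (Suc k - i)))"
  proof -
    have z: "scalar 0 * w = 0" for w :: "'a exterior" by (rule exterior_eqI) simp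
    show ?thesis by (subst sum.atMost_Suc_shift) (simp add: z)
  qed
  also have "(\<Sum>i\<le>k. exp_term x i * (y * exp_term y (k - i))) =
      (\<Sum>i\<le>k. scalar (of_nat (Suc k - i)) * (exp_term x i * exp_term y (Suc k - i)))"
  proof (rule sum.cong)
    fix i assume i: "i \<in> {..k}"
    then have e: "Suc k - i = Suc (k - i)" by auto
    show "exp_term x i * (y * exp_term y (k - i)) =
        scalar (of_nat (Suc k - i)) * (exp_term x i * exp_term y (Suc k - i))"
      unfolding e S[symmetric] by (metis mult.assoc scalar_commute)
  qed simp
  also have "\<dots> = (\<Sum>i\<le>Suc k. scalar (of_nat (Suc k - i)) * (exp_term x i * exp_term y (Suc k - i)))"
  proof -
    have z: "scalar 0 * w = 0" for w :: "'a exterior" by (rule exterior_eqI) simp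
    show ?thesis by (simp add: z)
  qed
  also have "(\<Sum>i\<le>Suc k. scalar (of_nat i) * (exp_term x i * exp_term y (Suc k - i))) + \<dots> =
      scalar (of_nat (Suc k)) * (\<Sum>i\<le>Suc k. exp_term x i * exp_term y (Suc k - i))"
    unfolding sum.distrib[symmetric] sum_distrib_left
    by (rule sum.cong) (auto simp: distrib_right[symmetric] scal_add[symmetric] of_nat_add[symmetric]
      simp del: of_nat_Suc of_nat_add)
  finally have eq: "scalar (of_nat (Suc k)) * exp_term (x + y) (Suc k) =
      scalar (of_nat (Suc k)) * (\<Sum>i\<le>Suc k. exp_term x i * exp_term y (Suc k - i))" .
  show ?case
  proof (rule exterior_eqI)
    fix A :: "'a set"
    from eq have "coeff (scalar (of_nat (Suc k)) * exp_term (x + y) (Suc k)) A =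
      coeff (scalar (of_nat (Suc k)) * (\<Sum>i\<le>Suc k. exp_term x i * exp_term y (Suc k - i))) A"
      by (rule arg_cong)
    then show "coeff (exp_term (x + y) (Suc k)) A =
        coeff (\<Sum>i\<le>Suc k. exp_term x i * exp_term y (Suc k - i)) A"
      unfolding coeff_scalar_mult by (simp del: of_nat_Suc sum.atMost_Suc)
  qed
qed

lemma exterior_exp_add:
  assumes x: "coeff x {} = 0" and y: "coeff y {} = 0" and comm: "x * y = y * x"
  shows "exterior_exp (x + y) = exterior_exp x * exterior_exp y"
proof (rule exterior_eqI)
  fix C :: "'a set" assume C: "finite C"
  define N where "N = card C"
  have trunc: "coeff (exterior_exp z) A = coeff (\<Sum>k\<le>N. exp_term z k) A"
    if "coeff z {} = 0" "A \<subseteq> C" for z A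
    using that C card_mono[of C A] unfolding N_def
    by (subst coeff_exterior_exp_finite[of _ _ "card C"]) (auto simp: exp_term_def)
  have ord: "order_ge k (exp_term z k)" if "coeff z {} = 0" for z :: "'a exterior" and k
    using order_ge_power[OF that, of k] unfolding order_ge_def exp_term_def by simp
  have high: "coeff (exp_term x i * exp_term y j) C = 0" if "i + j > N" for i j
    using order_ge_mult[OF ord[OF x] ord[OF y], of i j] that unfolding order_ge_def N_def by auto
  have "coeff (exterior_exp x * exterior_exp y) C =
      coeff ((\<Sum>i\<le>N. exp_term x i) * (\<Sum>j\<le>N. exp_term y j)) C"
    unfolding coeff_mult by (rule sum.cong) (simp_all add: trunc x y del: coeff_sum)
  also have "\<dots> = (\<Sum>(i, j)\<in>{..N} \<times> {..N}. coeff (exp_term x i * exp_term y j) C)"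
    by (simp add: sum_product sum.cartesian_product split_def)
  also have "\<dots> = (\<Sum>(i, j)\<in>{(i, j). i + j \<le> N}. coeff (exp_term x i * exp_term y j) C)"
    by (rule sum.mono_neutral_right) (auto intro: high simp: not_le[symmetric])
  also have "\<dots> = (\<Sum>k\<le>N. \<Sum>i\<le>k. coeff (exp_term x i * exp_term y (k - i)) C)"
    by (rule sum.triangle_reindex_eq)
  also have "\<dots> = coeff (exterior_exp (x + y)) C"
    by (simp add: trunc x y exp_term_add_commuting[OF comm])
  finally show "coeff (exterior_exp (x + y)) C = coeff (exterior_exp x * exterior_exp y) C" by simp
qed


section \<open>The characters of the additive supergroup\<close>

text \<open>Points of \<open>G\<close> and of \<open>T\<close> with values in a superspace are given by their coordinates, which are
  tuples of odd superfunctions \<open>g\<^sup>1, \<dots>, g\<^sup>n\<close> and \<open>t\<^sub>1, \<dots>, t\<^sub>n\<close>; the group law of \<open>G\<close> adds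
  coordinates. A \<open>T\<close>-family of superfunctions on \<open>G\<close> is given by its values on such points.\<close>

definition pairing :: "nat \<Rightarrow> (nat \<Rightarrow> 'a::linorder exterior) \<Rightarrow> (nat \<Rightarrow> 'a exterior) \<Rightarrow> 'a exterior" where
  "pairing n t g = (\<Sum>j=1..n. t j * g j)"

definition character :: "nat \<Rightarrow> (nat \<Rightarrow> 'a::linorder exterior) \<Rightarrow> (nat \<Rightarrow> 'a exterior) \<Rightarrow> 'a exterior" where
  "character n t g = exterior_exp (scalar \<i> * pairing n t g)"

definition polarised_section ::
  "nat \<Rightarrow> (nat \<Rightarrow> 'a::linorder exterior) \<Rightarrow> (nat \<Rightarrow> 'a exterior) \<Rightarrow> 'a exterior" where
  "polarised_section n t h = exterior_exp (scalar (- \<i>) * pairing n t h)"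

definition left_regular ::
  "(nat \<Rightarrow> 'a exterior) \<Rightarrow> ((nat \<Rightarrow> 'a exterior) \<Rightarrow> 'a exterior) \<Rightarrow> (nat \<Rightarrow> 'a exterior) \<Rightarrow> 'a exterior" where
  "left_regular g \<psi> = (\<lambda>h. \<psi> (\<lambda>j. h j - g j))"

context
  fixes n :: nat and t :: "nat \<Rightarrow> 'a::linorder exterior"
  assumes t: "\<And>j. has_parity 1 (t j)"
begin

lemma pairing_even: "(\<And>j. has_parity 1 (g j)) \<Longrightarrow> has_parity 0 (pairing n t g)"
  unfolding pairing_def
proof (rule has_parity_sum)
  fix j assume "\<And>j. has_parity 1 (g j)"
  then have "has_parity (1 + 1) (t j * g j)" by (intro has_parity_mult t)
  then show "has_parity 0 (t j * g j)" by (simp add: has_parity_def)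
qed

lemma pairing_nilpotent: "coeff (pairing n t g) {} = 0"
proof -
  have "coeff (t j) {} = 0" for j using t[of j] unfolding has_parity_def by force
  then show ?thesis unfolding pairing_def by (simp add: coeff_mult)
qed

lemma character_zero: "character n t (\<lambda>_. 0) = 1"
  by (simp add: character_def pairing_def exterior_exp_zero)

lemma character_add:
  assumes "\<And>j. has_parity 1 (g j)" "\<And>j. has_parity 1 (h j)"
  shows "character n t (\<lambda>j. g j + h j) = character n t g * character n t h"
proof -
  have "pairing n t (\<lambda>j. g j + h j) = pairing n t g + pairing n t h"
    by (simp add: pairing_def distrib_left sum.distrib)
  then show ?thesis unfolding character_def distrib_left
    by (metis (no_types, lifting) assms coeff_scalar_mult even_commute exterior_exp_add
        has_parity_scalar mult_zero_right pairing_even pairing_nilpotent distrib_left)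
qed

text \<open>The section \<open>\<psi>\<^sub>0\<close> is an eigenvector of the left regular representation, and the eigenvalue is the
  character.\<close>

lemma left_regular_polarised_section:
  assumes "\<And>j. has_parity 1 (g j)" "\<And>j. has_parity 1 (h j)"
  shows "left_regular g (polarised_section n t) h = character n t g * polarised_section n t h"
proof -
  have "scalar (- \<i>) * pairing n t (\<lambda>j. h j - g j) =
      scalar \<i> * pairing n t g + scalar (- \<i>) * pairing n t h"
    by (rule exterior_eqI) (simp add: pairing_def right_diff_distrib sum_subtractf)
  then show ?thesis unfolding character_def polarised_section_def left_regular_def
    by (metis (no_types, lifting) assms coeff_scalar_mult even_commute exterior_exp_add
        has_parity_scalar mult_zero_right pairing_even pairing_nilpotent)
qed

end


section \<open>Superfunctions on \<open>T \<times> G\<close> and Berezin integrals\<close>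

text \<open>\<open>Theta j\<close> and \<open>Xi j\<close>, for \<open>1 \<le> j \<le> n\<close>, index the coordinates \<open>\<theta>\<^sub>j\<close> on \<open>T\<close> and \<open>\<xi>\<^sup>j\<close> on \<open>G\<close>. The
  order is \<open>\<theta>\<^sub>1 < \<theta>\<^sub>2 < \<dots> < \<xi>\<^sup>1 < \<xi>\<^sup>2 < \<dots>\<close>.\<close>

datatype coordinate = Theta nat | Xi nat

fun coordinate_key :: "coordinate \<Rightarrow> nat \<times> nat" where
  "coordinate_key (Theta j) = (0, j)"
| "coordinate_key (Xi j) = (1, j)"

lemma coordinate_key_eq_iff: "coordinate_key x = coordinate_key y \<longleftrightarrow> x = y"
  by (cases x; cases y) auto

instantiation coordinate :: linorder
begin

definition less_eq_coordinate :: "coordinate \<Rightarrow> coordinate \<Rightarrow> bool" where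
  "x \<le> y \<longleftrightarrow> coordinate_key x \<le> coordinate_key y"

definition less_coordinate :: "coordinate \<Rightarrow> coordinate \<Rightarrow> bool" where
  "x < y \<longleftrightarrow> coordinate_key x < coordinate_key y"

instance
proof
  fix x y z :: coordinate
  show "x \<le> y \<Longrightarrow> y \<le> z \<Longrightarrow> x \<le> z"
    unfolding less_eq_coordinate_def by (rule order.trans)
  show "x \<le> y \<Longrightarrow> y \<le> x \<Longrightarrow> x = y"
    unfolding less_eq_coordinate_def coordinate_key_eq_iff[symmetric] by (rule order.antisym)
  show "x < y \<longleftrightarrow> x \<le> y \<and> \<not> y \<le> x"
    unfolding less_eq_coordinate_def less_coordinate_def by (rule less_le_not_le)
  show "x \<le> x" "x \<le> y \<or> y \<le> x"
    unfolding less_eq_coordinate_def by (rule order.refl linear)+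
qed

end

lemma coordinate_less_iff [simp]:
  "Theta i < Theta j \<longleftrightarrow> i < j" "Xi i < Xi j \<longleftrightarrow> i < j" "Theta i < Xi j" "\<not> Xi i < Theta j"
  by (auto simp: less_coordinate_def)

definition T_coordinates :: "nat \<Rightarrow> coordinate set" where
  "T_coordinates n = Theta ` {1..n}"

definition G_coordinates :: "nat \<Rightarrow> coordinate set" where
  "G_coordinates n = Xi ` {1..n}"

definition superfunctions_T :: "nat \<Rightarrow> coordinate exterior set" where
  "superfunctions_T n = exterior_on (T_coordinates n)"

definition superfunctions_G :: "nat \<Rightarrow> coordinate exterior set" where
  "superfunctions_G n = exterior_on (G_coordinates n)"

definition theta :: "nat \<Rightarrow> coordinate exterior" where
  "theta j = generator (Theta j)"

definition xi :: "nat \<Rightarrow> coordinate exterior" where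
  "xi j = generator (Xi j)"

lemma has_parity_theta: "has_parity 1 (theta j)" and has_parity_xi: "has_parity 1 (xi j)"
  unfolding theta_def xi_def by (rule has_parity_generator)+

text \<open>\<open>\<integral>\<^sub>T D(\<theta>)\<close> is the coefficient of \<open>\<theta>\<^sub>1 \<cdots> \<theta>\<^sub>n\<close>. The integral \<open>\<integral>\<^sub>G D(\<xi>)\<close> over the fibres of \<open>T \<times> G\<close> over \<open>T\<close>
  has parity \<open>n\<close> and is linear over superfunctions on \<open>T\<close> with the sign rule: it sends
  \<open>\<theta>\<^sub>I \<xi>\<^sup>1 \<cdots> \<xi>\<^sup>n\<close> to \<open>(-1)\<^sup>n\<^sup>|\<^sup>I\<^sup>| \<theta>\<^sub>I\<close> and the other \<open>\<theta>\<^sub>I \<xi>\<^sup>J\<close> to \<open>0\<close>.\<close>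

definition berezin_T :: "nat \<Rightarrow> coordinate exterior \<Rightarrow> complex" where
  "berezin_T n u = coeff u (T_coordinates n)"

lift_definition berezin_G :: "nat \<Rightarrow> coordinate exterior \<Rightarrow> coordinate exterior" is
  "\<lambda>n u I. if I \<subseteq> T_coordinates n then (-1) ^ (n * card I) * u (I \<union> G_coordinates n) else 0"
  by (auto simp: T_coordinates_def dest: finite_subset)

lemma coeff_berezin_G: "coeff (berezin_G n u) I =
    (if I \<subseteq> T_coordinates n then (-1) ^ (n * card I) * coeff u (I \<union> G_coordinates n) else 0)"
  by transfer simp

lemma finite_coordinates [simp]: "finite (T_coordinates n)" "finite (G_coordinates n)"
  by (simp_all add: T_coordinates_def G_coordinates_def)

lemma coordinates_disjoint: "T_coordinates n \<inter> G_coordinates n = {}"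
  by (auto simp: T_coordinates_def G_coordinates_def)

lemma monomial_T_coordinates: "monomial (T_coordinates n) = prod_list (map theta [1..<Suc n])"
  and monomial_G_coordinates: "monomial (G_coordinates n) = prod_list (map xi [1..<Suc n])"
proof -
  have s: "sorted_wrt (<) (map f [1..<Suc n])" if "\<And>i j. f i < f j \<longleftrightarrow> i < j"
    for f :: "nat \<Rightarrow> coordinate"
    unfolding sorted_wrt_map that by (rule sorted_wrt_upt)
  have "set (map f [1..<Suc n]) = f ` {1..n}" for f :: "nat \<Rightarrow> coordinate"
    by (simp only: set_map set_upt atLeastLessThanSuc_atLeastAtMost)
  then show "monomial (T_coordinates n) = prod_list (map theta [1..<Suc n])"
    "monomial (G_coordinates n) = prod_list (map xi [1..<Suc n])"
    using monomial_eq_prod_list[OF s, of Theta] monomial_eq_prod_list[OF s, of Xi]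
    by (simp_all add: T_coordinates_def G_coordinates_def map_map o_def theta_def[abs_def] xi_def[abs_def]
      del: upt_Suc)
qed

lemma berezin_G_in_superfunctions_T: "berezin_G n u \<in> superfunctions_T n"
  by (simp add: superfunctions_T_def exterior_on_def coeff_berezin_G)

lemma berezin_G_add: "berezin_G n (u + v) = berezin_G n u + berezin_G n v"
  by (rule exterior_eqI) (simp add: coeff_berezin_G distrib_left)

lemma berezin_G_scalar: "berezin_G n (scalar c * u) = scalar c * berezin_G n u"
  by (rule exterior_eqI) (simp add: coeff_berezin_G)

lemma berezin_G_monomial:
  assumes "I \<subseteq> T_coordinates n" "J \<subseteq> G_coordinates n"
  shows "berezin_G n (monomial I * monomial J) =
    (if J = G_coordinates n then scalar ((-1) ^ (n * card I)) * monomial I else 0)"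
proof (rule exterior_eqI)
  fix K :: "coordinate set"
  have fin: "finite I" "finite J" using assms finite_subset finite_coordinates by metis+
  have "{(a, b) \<in> I \<times> J. b < a} = {}"
    using assms by (fastforce simp: T_coordinates_def G_coordinates_def dest: order.asym)
  then have s: "reorder_sign I J = 1" unfolding reorder_sign_def by (simp only: card.empty power_0)
  have d: "I \<inter> J = {}" using assms coordinates_disjoint[of n] by auto
  have "K \<union> G_coordinates n = I \<union> J \<longleftrightarrow> K = I \<and> J = G_coordinates n" if "K \<subseteq> T_coordinates n"
    using that assms coordinates_disjoint[of n] by blast
  then show "coeff (berezin_G n (monomial I * monomial J)) K =
      coeff (if J = G_coordinates n then scalar ((-1) ^ (n * card I)) * monomial I else 0) K"
    using assms fin d s by (auto simp: coeff_berezin_G monomial_mult coeff_monomial)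
qed


section \<open>Representations on free modules, and supertraces\<close>

text \<open>An endomorphism \<open>L\<close> of the free module with even basis \<open>\<psi>\<^sub>0, \<dots>, \<psi>\<^sub>p\<^sub>-\<^sub>1\<close> and odd basis
  \<open>\<psi>\<^sub>p, \<dots>, \<psi>\<^sub>p\<^sub>+\<^sub>q\<^sub>-\<^sub>1\<close> is given by the matrix of left coefficients \<open>L \<psi>\<^sub>l = \<Sum>\<^sub>k M k l \<psi>\<^sub>k\<close>. With left
  coefficients, no parity of the entries enters the supertrace.\<close>

definition supertrace :: "nat \<Rightarrow> nat \<Rightarrow> (nat \<Rightarrow> nat \<Rightarrow> 'a exterior) \<Rightarrow> 'a exterior" where
  "supertrace p q M = (\<Sum>k<p. M k k) - (\<Sum>k=p..<p + q. M k k)"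

text \<open>The representation \<open>\<pi>\<close> of \<open>G\<^sub>T\<close> at the generic point of \<open>T \<times> G\<close>: its matrix on the module of rank
  \<open>1|0\<close> with basis \<open>\<psi>\<^sub>0\<close>.\<close>

definition pi_rep :: "nat \<Rightarrow> nat \<Rightarrow> nat \<Rightarrow> coordinate exterior" where
  "pi_rep n k l = (if k = 0 \<and> l = 0 then character n theta xi else 0)"

text \<open>The operator \<open>\<pi>(f) = \<integral>\<^sub>G D(\<xi>) f \<pi>\<close>; the basis does not depend on \<open>\<xi>\<close>, so the integral is taken of
  each left coefficient.\<close>

definition integrated_rep ::
  "nat \<Rightarrow> (nat \<Rightarrow> nat \<Rightarrow> coordinate exterior) \<Rightarrow> coordinate exterior \<Rightarrow> nat \<Rightarrow> nat \<Rightarrow> coordinate exterior" where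
  "integrated_rep n \<pi> f k l = berezin_G n (f * \<pi> k l)"

text \<open>The value of a superfunction at the point with vanishing coordinates.\<close>

definition value_at_origin :: "'a exterior \<Rightarrow> complex" where
  "value_at_origin f = coeff f {}"

end

(* The character factors as the product of the 1 + i theta_j xi^j, so it is the sum over S of
   i^|S| times the product of the theta_j xi^j for j in S; sorting the latter into theta_S xi^S
   costs the sign (-1)^(|S|(|S|-1)/2). A superfunction f on G contains no theta_j, so the coefficient
   of theta_1 ... theta_n xi^1 ... xi^n in f pi only involves the term S = {1..n} and hence only the
   constant term of f. The fibre integral contributes the remaining sign (-1)^(n^2) = (-1)^n. *)

theory Submission
  imports Defs
begin

text \<open>From the second power on, every term of the exponential series vanishes.\<close>

lemma exterior_exp_square_zero:
  fixes x :: "'a::linorder exterior"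
  assumes "x * x = 0"
  shows "exterior_exp x = 1 + x"
proof (rule exterior_eqI)
  fix A :: "'a set"
  have "x ^ k = 0" if "k \<notin> {0, 1}" for k
    using that assms by (cases k rule: nat.exhaust; cases "k - 1") (auto simp: mult.assoc[symmetric])
  then have "(\<Sum>k. coeff (x ^ k) A / fact k) = (\<Sum>k\<in>{0, 1}. coeff (x ^ k) A / fact k)"
    by (intro suminf_finite) auto
  then show "coeff (exterior_exp x) A = coeff (1 + x) A"
    by (simp add: coeff_exterior_exp)
qed

text \<open>Every \<open>Theta\<close> precedes every \<open>Xi\<close> in the order of coordinates,
  so the monomial of this set is \<open>theta_S xi^S\<close>, already sorted.\<close>

definition paired_coordinates :: "nat set \<Rightarrow> coordinate set" where
  "paired_coordinates S = Theta ` S \<union> Xi ` S"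

lemma finite_paired_coordinates [simp]: "finite S \<Longrightarrow> finite (paired_coordinates S)"
  by (simp add: paired_coordinates_def)

lemma Theta_in_paired_coordinates [simp]: "Theta j \<in> paired_coordinates S \<longleftrightarrow> j \<in> S"
  and Xi_in_paired_coordinates [simp]: "Xi j \<in> paired_coordinates S \<longleftrightarrow> j \<in> S"
  by (auto simp: paired_coordinates_def)

lemma paired_coordinates_eq_iff [simp]: "paired_coordinates S = paired_coordinates S' \<longleftrightarrow> S = S'"
  by (metis Theta_in_paired_coordinates subsetI subset_antisym)

lemma paired_coordinates_insert:
  "paired_coordinates (insert m S) = paired_coordinates S \<union> paired_coordinates {m}"
  by (auto simp: paired_coordinates_def)

lemma paired_coordinates_interval:
  "paired_coordinates {1..n} = T_coordinates n \<union> G_coordinates n"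
  by (simp add: paired_coordinates_def T_coordinates_def G_coordinates_def)

lemma theta_mult_xi: "theta m * xi m = monomial (paired_coordinates {m})"
proof -
  have "{(a, b) \<in> {Theta m} \<times> {Xi m}. b < a} = {}" by auto
  then have "reorder_sign {Theta m} {Xi m} = 1"
    unfolding reorder_sign_def by (simp only: card.empty power_0)
  then show ?thesis
    by (simp add: theta_def xi_def monomial_mult scalar_one paired_coordinates_def insert_commute)
qed

text \<open>As \<open>m\<close> exceeds all of \<open>S\<close>, \<open>Xi m\<close> stays last and
  \<open>Theta m\<close> stays behind every \<open>Theta j\<close>. Sorting only moves
  \<open>Theta m\<close> past the \<open>card S\<close> factors \<open>Xi j\<close>, one sign
  each.\<close>

lemma monomial_paired_mult:
  assumes "finite S" "\<And>j. j \<in> S \<Longrightarrow> j < m"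
  shows "monomial (paired_coordinates S) * (theta m * xi m) =
    scalar ((-1) ^ card S) * monomial (paired_coordinates (insert m S))"
proof -
  have "{(a, b) \<in> paired_coordinates S \<times> paired_coordinates {m}. b < a} = Xi ` S \<times> {Theta m}"
    using assms(2) by (force simp: paired_coordinates_def less_coordinate_def)
  moreover have "card (Xi ` S \<times> {Theta m}) = card S"
    by (simp add: card_cartesian_product card_image inj_on_def)
  ultimately have "reorder_sign (paired_coordinates S) (paired_coordinates {m}) = (-1) ^ card S"
    unfolding reorder_sign_def by simp
  moreover have "paired_coordinates S \<inter> paired_coordinates {m} = {}"
    using assms(2) by (force simp: paired_coordinates_def)
  ultimately show ?thesis
    using assms(1) unfolding theta_mult_xi by (simp add: monomial_mult paired_coordinates_insert[of m S])
qed

lemma scalar_left_commute: "x * (scalar c * y) = scalar c * (x * y)"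
  by (simp add: scalar_commute[of x] flip: mult.assoc)

text \<open>The summand added to the exponent is even, so it commutes with the rest and its
  exponential splits off as a factor. It squares to zero, so this factor is 1 plus the
  summand.\<close>

lemma character_Suc:
  "character (Suc n) theta xi =
    character n theta xi + character n theta xi * (scalar \<i> * (theta (Suc n) * xi (Suc n)))"
proof -
  let ?y = "scalar \<i> * (theta (Suc n) * xi (Suc n))"
  have par: "has_parity 0 ?y"
    using has_parity_scalar[OF has_parity_mult[OF has_parity_theta has_parity_xi]]
    by (simp add: has_parity_def)
  have par': "has_parity 0 (scalar \<i> * pairing n theta xi)"
    by (intro has_parity_scalar pairing_even has_parity_theta has_parity_xi)
  \<comment> \<open>With the scalars collected on the left, a nonempty monomial times itself
    remains, which is zero.\<close>
  have "?y * ?y = scalar \<i> * (scalar \<i> * (theta (Suc n) * xi (Suc n) * (theta (Suc n) * xi (Suc n))))"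
    by (simp only: mult.assoc scalar_left_commute[of "theta _"] scalar_left_commute[of "xi _"])
  then have sq: "?y * ?y = 0"
    unfolding theta_mult_xi by (simp add: monomial_mult paired_coordinates_def)
  have "character (Suc n) theta xi = exterior_exp (scalar \<i> * pairing n theta xi + ?y)"
    by (simp add: character_def pairing_def distrib_left)
  also have "\<dots> = character n theta xi * exterior_exp ?y"
    unfolding character_def
  proof (rule exterior_exp_add)
    show "coeff (scalar \<i> * pairing n theta xi) {} = 0"
      by (simp add: pairing_nilpotent[OF has_parity_theta])
    show "coeff ?y {} = 0"
      by (simp add: theta_mult_xi coeff_monomial paired_coordinates_def)
  qed (rule even_commute[OF par' par])
  finally show ?thesis
    by (simp add: exterior_exp_square_zero[OF sq] distrib_left)
qed

text \<open>Induction on \<open>n\<close>: the two terms of the new factor correspond to the subsets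
  without and with the new index. Inserting the elements of \<open>S\<close> in increasing order
  costs 0 + 1 + ... + (\<open>card S\<close> - 1) sign changes, that is,
  \<open>card S choose 2\<close>.\<close>

lemma character_expansion:
  "character n theta xi =
    (\<Sum>S\<in>Pow {1..n}. scalar (\<i> ^ card S * (-1) ^ (card S choose 2)) * monomial (paired_coordinates S))"
proof (induction n)
  case 0
  then show ?case
    by (simp add: character_def pairing_def exterior_exp_zero scalar_one paired_coordinates_def monomial_empty
        binomial_eq_0)
next
  case (Suc n)
  let ?c = "\<lambda>S. \<i> ^ card S * (-1) ^ (card S choose 2)"
  let ?f = "\<lambda>S. scalar (?c S) * monomial (paired_coordinates S)"
  have step: "?f S * (scalar \<i> * (theta (Suc n) * xi (Suc n))) = ?f (insert (Suc n) S)"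
    if "S \<in> Pow {1..n}" for S
  proof -
    have S: "finite S" "Suc n \<notin> S" "\<And>j. j \<in> S \<Longrightarrow> j < Suc n"
      using that by (auto intro: finite_subset)
    have "?f S * (scalar \<i> * (theta (Suc n) * xi (Suc n))) =
        scalar (?c S) * scalar \<i> * (monomial (paired_coordinates S) * (theta (Suc n) * xi (Suc n)))"
      by (simp only: mult.assoc scalar_left_commute[of "monomial _"])
    also have "\<dots> = ?f (insert (Suc n) S)"
    proof -
      \<comment> \<open>Pascal's rule: \<open>Suc k choose 2\<close> equals
        \<open>k + (k choose 2)\<close>.\<close>
      have "?c S * \<i> * (-1) ^ card S = ?c (insert (Suc n) S)"
        using S by (simp add: numeral_2_eq_2 power_add)
      moreover have "monomial (paired_coordinates S) * (theta (Suc n) * xi (Suc n)) =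
          scalar ((-1) ^ card S) * monomial (paired_coordinates (insert (Suc n) S))"
        by (rule monomial_paired_mult) (fact S)+
      ultimately show ?thesis
        by (simp only: scalar_mult flip: mult.assoc)
    qed
    finally show ?thesis .
  qed
  \<comment> \<open>None of these subsets contains \<open>Suc n\<close>, so deleting it undoes the
    insertion.\<close>
  have inj: "inj_on (insert (Suc n)) (Pow {1..n})"
    by (rule inj_onI) (metis Diff_insert_absorb PowD Suc_n_not_le_n atLeastAtMost_iff subsetD)
  have "{1..Suc n} = insert (Suc n) {1..n}" by auto
  then have "Pow {1..Suc n} = Pow {1..n} \<union> insert (Suc n) ` Pow {1..n}"
    by (simp only: Pow_insert)
  then have "(\<Sum>S\<in>Pow {1..Suc n}. ?f S) =
      (\<Sum>S\<in>Pow {1..n}. ?f S) + (\<Sum>S\<in>insert (Suc n) ` Pow {1..n}. ?f S)"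
    by (simp only:) (rule sum.union_disjoint, auto)
  also have "(\<Sum>S\<in>insert (Suc n) ` Pow {1..n}. ?f S) =
      (\<Sum>S\<in>Pow {1..n}. ?f S) * (scalar \<i> * (theta (Suc n) * xi (Suc n)))"
    by (simp only: sum.reindex[OF inj] o_def sum_distrib_right) (rule sum.cong, simp_all only: step)
  finally show ?case
    using Suc.IH by (simp only: character_Suc)
qed

text \<open>\<open>S\<close> can be read off from the \<open>Theta\<close> elements of
  \<open>paired_coordinates S\<close>. Since \<open>B\<close> contains all of them, only the term of
  the expansion with \<open>S = {1..n}\<close> can contribute.\<close>

lemma coeff_character:
  assumes "T_coordinates n \<subseteq> B" "B \<subseteq> T_coordinates n \<union> G_coordinates n"
  shows "coeff (character n theta xi) B =
    (if B = T_coordinates n \<union> G_coordinates n then \<i> ^ n * (-1) ^ (n choose 2) else 0)"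
proof -
  have iff: "B = paired_coordinates S \<longleftrightarrow> S = {1..n} \<and> B = T_coordinates n \<union> G_coordinates n"
    if "S \<in> Pow {1..n}" for S
  proof -
    have "S = {1..n}" if "B = paired_coordinates S"
      using that \<open>S \<in> Pow {1..n}\<close> assms(1) by (auto simp: T_coordinates_def)
    then show ?thesis
      unfolding paired_coordinates_interval[symmetric] by blast
  qed
  have "coeff (character n theta xi) B = (\<Sum>S\<in>Pow {1..n}. if S = {1..n} then
      (if B = T_coordinates n \<union> G_coordinates n then \<i> ^ n * (-1) ^ (n choose 2) else 0) else 0)"
    unfolding character_expansion coeff_sum coeff_scalar_mult coeff_monomial
    by (rule sum.cong) (use iff finite_subset[of _ "{1..n}"] in auto)
  then show ?thesis by simp
qed

text \<open>In the product formula, \<open>A\<close> is the part of the top monomial taken from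
  \<open>f\<close>. As \<open>f\<close> involves no \<open>Theta\<close>, the character must supply
  all of them, and then it supplies every \<open>Xi\<close> as well. Hence \<open>A = {}\<close>,
  with reordering sign 1.\<close>

lemma coeff_mult_character:
  assumes "f \<in> superfunctions_G n"
  shows "coeff (f * character n theta xi) (T_coordinates n \<union> G_coordinates n) =
    coeff f {} * (\<i> ^ n * (-1) ^ (n choose 2))"
proof -
  let ?C = "T_coordinates n \<union> G_coordinates n"
  have "coeff (f * character n theta xi) ?C =
      (\<Sum>A\<in>Pow ?C. if A = {} then coeff f {} * (\<i> ^ n * (-1) ^ (n choose 2)) else 0)"
    unfolding coeff_mult
  proof (rule sum.cong)
    fix A assume A: "A \<in> Pow ?C"
    show "reorder_sign A (?C - A) * coeff f A * coeff (character n theta xi) (?C - A) =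
        (if A = {} then coeff f {} * (\<i> ^ n * (-1) ^ (n choose 2)) else 0)"
    proof (cases "coeff f A = 0")
      case False
      then have "A \<subseteq> G_coordinates n"
        using assms by (auto simp: superfunctions_G_def exterior_on_def)
      then have "T_coordinates n \<subseteq> ?C - A"
        using coordinates_disjoint[of n] by blast
      moreover have "?C - A = ?C \<longleftrightarrow> A = {}" using A by blast
      ultimately show ?thesis by (simp add: coeff_character)
    qed auto
  qed simp
  then show ?thesis by simp
qed

theorem proposition6p4:
  fixes n :: nat and f :: "coordinate exterior"
  assumes "f \<in> superfunctions_G n"
  shows "berezin_T n (supertrace 1 0 (integrated_rep n (pi_rep n) f)) =
    (-1) ^ (n * (n + 1) div 2) * \<i> ^ n * value_at_origin f"
proof -
  have card: "card (T_coordinates n) = n"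
    by (simp add: T_coordinates_def card_image inj_on_def)
  have "n * (n + 1) div 2 = n + (n choose 2)"
    using choose_two[of "Suc n"] by (simp add: numeral_2_eq_2 mult.commute)
  \<comment> \<open>\<open>n\<close> and \<open>n * n\<close> have the same parity; the latter is
    the exponent that \<open>berezin_G\<close> produces at the top monomial in the
    \<open>Theta\<close>.\<close>
  then have sign: "(-1 :: complex) ^ (n * (n + 1) div 2) = (-1) ^ (n * n) * (-1) ^ (n choose 2)"
    by (simp add: power_add uminus_power_if)
  have "berezin_T n (supertrace 1 0 (integrated_rep n (pi_rep n) f)) =
      (-1) ^ (n * n) * coeff (f * character n theta xi) (T_coordinates n \<union> G_coordinates n)"
    by (simp add: berezin_T_def supertrace_def integrated_rep_def pi_rep_def coeff_berezin_G card)
  then show ?thesis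
    unfolding coeff_mult_character[OF assms] sign value_at_origin_def by simp
qed

end
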